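(* Let $n\ge 0$ be an integer and let $P\in\mathbb{Q}[x_0,x_1,\ldots,x_n]$ be a polynomial. (i) If $\mathcal{D}_{\mathcal{K}_1}(P(x_0,x_1,\ldots,x_n))=0$, then $P(K_0(x,a),K_1(x,a),\ldots,K_n(x,a))\in\mathbb{Q}[a]$. (ii) If $\mathcal{D}_{\mathcal{K}_2}(P(x_0,x_1,\ldots,x_n))=0$, then $P(K_0(x,a),K_1(x,a),\ldots,K_n(x,a))\in\mathbb{Q}[x]$.
   Context: The binary Kravchuk polynomials are the polynomials $K_m(x,a)\in\mathbb{Q}[x,a]$ defined by $$K_m(x,a):=\sum_{i=0}^m(-1)^i\binom{x}{i}\binom{a-x}{m-i},\qquad m=0,1,2,\ldots,$$ where $\binom{t}{i}=t(t-1)\cdots(t-i+1)/i!$. A derivation of $\mathbb{Q}[x_0,\ldots,x_n]$ is a $\mathbb{Q}$-linear map $D$ satisfying the Leibniz rule $D(fg)=D(f)g+fD(g)$; it is determined by the values $D(x_m)$. The first Kravchuk derivation $\mathcal{D}_{\mathcal{K}_1}$ and the second Kravchuk derivation $\mathcal{D}_{\mathcal{K}_2}$ are the derivations of $\mathbb{Q}[x_0,\ldots,x_n]$ given by $$\mathcal{D}_{\mathcal{K}_1}(x_0)=0,\qquad \mathcal{D}_{\mathcal{K}_1}(x_m)=\sum_{i=1}^{m}\frac{1-(-1)^i}{2i}\,x_{m-i},$$ $$\mathcal{D}_{\mathcal{K}_2}(x_0)=0,\qquad \mathcal{D}_{\mathcal{K}_2}(x_m)=\sum_{i=0}^{m-1}\frac{(-1)^{m+1+i}}{m-i}\,x_i,$$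 for $1\le m\le n$. *)

theory Defs
  imports Complex_Main "HOL-Library.Poly_Mapping" "HOL-Computational_Algebra.Polynomial"
begin

text \<open>
  Polynomials over the rationals in variables indexed by the naturals: a monomial is an
  exponent vector of type \<^typ>\<open>nat \<Rightarrow>\<^sub>0 nat\<close>, and the product on \<^type>\<open>poly_mapping\<close> is the
  convolution product.
\<close>

type_synonym ratmpoly = "(nat \<Rightarrow>\<^sub>0 nat) \<Rightarrow>\<^sub>0 rat"

definition Const :: "rat \<Rightarrow> ratmpoly" where
  "Const c = Poly_Mapping.single 0 c"

definition Var :: "nat \<Rightarrow> ratmpoly" where
  "Var i = Poly_Mapping.single (Poly_Mapping.single i 1) 1"

definition poly_ring :: "nat \<Rightarrow> ratmpoly set" where
  "poly_ring n = {P. \<forall>m\<in>Poly_Mapping.keys P. Poly_Mapping.keys m \<subseteq> {0..n}}"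

definition is_derivation :: "nat \<Rightarrow> (ratmpoly \<Rightarrow> ratmpoly) \<Rightarrow> bool" where
  "is_derivation n D \<longleftrightarrow>
     (\<forall>f\<in>poly_ring n. D f \<in> poly_ring n) \<and>
     (\<forall>f\<in>poly_ring n. \<forall>g\<in>poly_ring n. D (f + g) = D f + D g) \<and>
     (\<forall>c. \<forall>f\<in>poly_ring n. D (Const c * f) = Const c * D f) \<and>
     (\<forall>f\<in>poly_ring n. \<forall>g\<in>poly_ring n. D (f * g) = D f * g + f * D g)"

definition is_first_Kravchuk_derivation :: "nat \<Rightarrow> (ratmpoly \<Rightarrow> ratmpoly) \<Rightarrow> bool" where
  "is_first_Kravchuk_derivation n D \<longleftrightarrow>
     is_derivation n D \<and>
     D (Var 0) = 0 \<and>
     (\<forall>m\<in>{1..n}. D (Var m) =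
        (\<Sum>i = 1..m. Const ((1 - (-1) ^ i) / (2 * of_nat i)) * Var (m - i)))"

definition is_second_Kravchuk_derivation :: "nat \<Rightarrow> (ratmpoly \<Rightarrow> ratmpoly) \<Rightarrow> bool" where
  "is_second_Kravchuk_derivation n D \<longleftrightarrow>
     is_derivation n D \<and>
     D (Var 0) = 0 \<and>
     (\<forall>m\<in>{1..n}. D (Var m) =
        (\<Sum>i = 0..m - 1. Const ((-1) ^ (m + 1 + i) / of_nat (m - i)) * Var i))"

text \<open>
  The ring \<open>\<rat>[x,a]\<close> is represented as \<^typ>\<open>rat poly poly\<close>, that is as \<open>\<rat>[a][x]\<close>: the outer
  variable is \<open>x\<close> and the inner one is \<open>a\<close>.
\<close>

definition var_x :: "rat poly poly" where
  "var_x = [:0, 1:]"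

definition var_a :: "rat poly poly" where
  "var_a = [:[:0, 1:]:]"

definition Q_a :: "rat poly poly set" where
  "Q_a = range (\<lambda>q :: rat poly. [:q:])"

definition Q_x :: "rat poly poly set" where
  "Q_x = range (map_poly (\<lambda>c :: rat. [:c:]))"

text \<open>
  Binomial coefficients with a polynomial on top; the library constrains \<^const>\<open>gbinomial\<close> to
  fields of characteristic 0.
\<close>

definition poly_choose :: "rat poly poly \<Rightarrow> nat \<Rightarrow> rat poly poly" where
  "poly_choose t i = [:[:1 / fact i:]:] * (\<Prod>j<i. t - of_nat j)"

definition Kravchuk :: "nat \<Rightarrow> rat poly poly" where
  "Kravchuk m =
     (\<Sum>i = 0..m. (-1) ^ i * poly_choose var_x i * poly_choose (var_a - var_x) (m - i))"

text \<open>The substitution \<open>P(k 0, k 1, \<dots>)\<close>.\<close>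

definition substitute :: "(nat \<Rightarrow> rat poly poly) \<Rightarrow> ratmpoly \<Rightarrow> rat poly poly" where
  "substitute k P =
     (\<Sum>m\<in>Poly_Mapping.keys P. [:[:Poly_Mapping.lookup P m:]:] *
        (\<Prod>i\<in>Poly_Mapping.keys m. k i ^ Poly_Mapping.lookup m i))"

text \<open>Both Kravchuk derivations exist: a derivation may be prescribed freely on the variables.\<close>

definition dmon :: "nat \<Rightarrow> (nat \<Rightarrow> ratmpoly) \<Rightarrow> (nat \<Rightarrow>\<^sub>0 nat) \<Rightarrow> ratmpoly" where
  "dmon n v m = (\<Sum>i\<le>n. v i *
     Poly_Mapping.single (m - Poly_Mapping.single i 1) (of_nat (Poly_Mapping.lookup m i)))"

definition der :: "nat \<Rightarrow> (nat \<Rightarrow> ratmpoly) \<Rightarrow> ratmpoly \<Rightarrow> ratmpoly" where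
  "der n v P = (\<Sum>m\<in>Poly_Mapping.keys P. Const (Poly_Mapping.lookup P m) * dmon n v m)"

lemma Const_add: "Const (a + b) = Const a + Const b"
  by (simp add: Const_def single_add)

lemma Const_mult: "Const (a * b) = Const a * Const b"
  by (simp add: Const_def mult_single)

lemma Const_0 [simp]: "Const 0 = 0"
  by (simp add: Const_def)

lemma der_add: "der n v (P + Q) = der n v P + der n v Q"
  unfolding der_def
  by (rule setsum_keys_plus_distrib) (simp_all add: Const_add algebra_simps)

lemma der_0 [simp]: "der n v 0 = 0"
  by (simp add: der_def)

lemma der_sum: "der n v (sum f A) = (\<Sum>x\<in>A. der n v (f x))"
  by (induction A rule: infinite_finite_induct) (simp_all add: der_add)

lemma der_single: "der n v (Poly_Mapping.single m c) = Const c * dmon n v m"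
  by (cases "c = 0") (simp_all add: der_def)

lemma monomials_sum: "(\<Sum>m\<in>Poly_Mapping.keys P. Poly_Mapping.single m (Poly_Mapping.lookup P m)) = P"
  for P :: ratmpoly
  by (rule poly_mapping_eqI)
     (auto simp: lookup_sum lookup_single when_def in_keys_iff)

lemma dmon_add:
  "dmon n v (m + m') = dmon n v m * Poly_Mapping.single m' 1 + Poly_Mapping.single m 1 * dmon n v m'"
proof -
  have shift: "Poly_Mapping.single (p + q - Poly_Mapping.single i 1) (of_nat (Poly_Mapping.lookup p i)) =
      Poly_Mapping.single (p - Poly_Mapping.single i 1) (of_nat (Poly_Mapping.lookup p i)) * Poly_Mapping.single q (1 :: rat)"
    for p q :: "nat \<Rightarrow>\<^sub>0 nat" and i
  proof (cases "Poly_Mapping.lookup p i = 0")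
    case False
    then have "p + q - Poly_Mapping.single i 1 = p - Poly_Mapping.single i 1 + q"
      by (intro poly_mapping_eqI) (auto simp: lookup_add lookup_minus lookup_single when_def)
    then show ?thesis
      by (simp add: mult_single)
  qed simp
  show ?thesis
    unfolding dmon_def lookup_add of_nat_add single_add sum_distrib_left sum_distrib_right
      sum.distrib[symmetric]
    by (intro sum.cong refl)
       (simp only: shift shift[of m' m, unfolded add.commute[of m' m]] distrib_left mult.assoc
          mult.left_commute mult.commute[of "Poly_Mapping.single m 1"])
qed

lemma der_mult: "der n v (P * Q) = der n v P * Q + P * der n v Q"
proof -
  have mono: "der n v (Poly_Mapping.single m a * Poly_Mapping.single m' b) =
      der n v (Poly_Mapping.single m a) * Poly_Mapping.single m' b +
      Poly_Mapping.single m a * der n v (Poly_Mapping.single m' b)" for m m' a b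
  proof -
    have s: "Poly_Mapping.single p c = Const c * Poly_Mapping.single p 1" for p c
      by (simp add: Const_def mult_single)
    have "der n v (Poly_Mapping.single m a * Poly_Mapping.single m' b) =
        Const (a * b) * dmon n v (m + m')"
      by (simp add: mult_single der_single)
    also have "\<dots> = Const a * dmon n v m * (Const b * Poly_Mapping.single m' 1) +
        Const a * Poly_Mapping.single m 1 * (Const b * dmon n v m')"
      by (simp add: dmon_add Const_mult algebra_simps)
    finally show ?thesis
      by (simp add: der_single s[symmetric])
  qed
  let ?s = "\<lambda>P m. Poly_Mapping.single m (Poly_Mapping.lookup P m) :: ratmpoly"
  let ?P = "\<Sum>m\<in>Poly_Mapping.keys P. ?s P m" and ?Q = "\<Sum>m\<in>Poly_Mapping.keys Q. ?s Q m"
  have "der n v (?P * ?Q) = der n v ?P * ?Q + ?P * der n v ?Q"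
    by (simp only: sum_product der_sum mono sum.distrib)
  then show ?thesis
    by (simp only: monomials_sum)
qed

lemma poly_ring_add: "P \<in> poly_ring n \<Longrightarrow> Q \<in> poly_ring n \<Longrightarrow> P + Q \<in> poly_ring n"
  unfolding poly_ring_def using keys_add[of P Q] by blast

lemma poly_ring_mult:
  assumes "P \<in> poly_ring n" "Q \<in> poly_ring n"
  shows "P * Q \<in> poly_ring n"
proof -
  have "Poly_Mapping.keys m \<subseteq> {0..n}" if m: "m \<in> Poly_Mapping.keys (P * Q)" for m
  proof -
    obtain p q where "m = p + q" "p \<in> Poly_Mapping.keys P" "q \<in> Poly_Mapping.keys Q"
      using m keys_mult[of P Q] by blast
    then show ?thesis
      using assms keys_add[of p q] unfolding poly_ring_def by blast
  qed
  then show ?thesis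
    by (simp add: poly_ring_def)
qed

lemma poly_ring_sum: "(\<And>x. x \<in> A \<Longrightarrow> f x \<in> poly_ring n) \<Longrightarrow> sum f A \<in> poly_ring n"
  by (induction A rule: infinite_finite_induct) (auto simp: poly_ring_add, auto simp: poly_ring_def)

lemma poly_ring_Const: "Const c \<in> poly_ring n"
  by (auto simp: poly_ring_def Const_def)

lemma poly_ring_Var: "i \<le> n \<Longrightarrow> Var i \<in> poly_ring n"
  by (auto simp: poly_ring_def Var_def)

lemma der_in_poly_ring:
  assumes "\<And>i. i \<le> n \<Longrightarrow> v i \<in> poly_ring n" "P \<in> poly_ring n"
  shows "der n v P \<in> poly_ring n"
proof -
  have "Poly_Mapping.single (m - Poly_Mapping.single i 1) c \<in> poly_ring n"
    if "m \<in> Poly_Mapping.keys P" for m i c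
  proof -
    have "Poly_Mapping.keys (m - Poly_Mapping.single i 1) \<subseteq> Poly_Mapping.keys m"
      by (auto simp: in_keys_iff lookup_minus)
    then show ?thesis
      using that assms(2) by (auto simp: poly_ring_def split: if_splits)
  qed
  then show ?thesis
    unfolding der_def dmon_def
    by (intro poly_ring_sum poly_ring_mult poly_ring_Const) (auto intro: assms(1))
qed

lemma der_Const [simp]: "der n v (Const c) = 0"
  by (simp add: Const_def der_single dmon_def)

lemma der_Var: "i \<le> n \<Longrightarrow> der n v (Var i) = v i"
proof -
  assume i: "i \<le> n"
  have "der n v (Var i) = dmon n v (Poly_Mapping.single i 1)"
    unfolding Var_def der_single by (simp add: Const_def)
  also have "\<dots> = (\<Sum>j\<le>n. if j = i then v j else 0)"
    unfolding dmon_def by (intro sum.cong refl) (auto simp: lookup_single when_def)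
  finally show ?thesis
    using i by simp
qed

lemma is_derivation_der:
  assumes "\<And>i. i \<le> n \<Longrightarrow> v i \<in> poly_ring n"
  shows "is_derivation n (der n v)"
  unfolding is_derivation_def
  by (auto simp: der_add der_mult der_in_poly_ring assms)

lemma ex_first_Kravchuk_derivation: "\<exists>D. is_first_Kravchuk_derivation n D"
proof
  let ?v = "\<lambda>m. \<Sum>i = 1..m. Const ((1 - (-1) ^ i) / (2 * of_nat i)) * Var (m - i)"
  have "is_derivation n (der n ?v)"
    by (intro is_derivation_der poly_ring_sum poly_ring_mult poly_ring_Const poly_ring_Var) auto
  then show "is_first_Kravchuk_derivation n (der n ?v)"
    by (auto simp: is_first_Kravchuk_derivation_def der_Var)
qed

lemma ex_second_Kravchuk_derivation: "\<exists>D. is_second_Kravchuk_derivation n D"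
proof
  let ?v = "\<lambda>m. if m = 0 then 0 else
    (\<Sum>i = 0..m - 1. Const ((-1) ^ (m + 1 + i) / of_nat (m - i)) * Var i)"
  have "is_derivation n (der n ?v)"
  proof (rule is_derivation_der)
    fix m assume "m \<le> n"
    then show "?v m \<in> poly_ring n"
      by (cases "m = 0")
         (auto simp: poly_ring_def[of n, THEN eqset_imp_iff, of 0]
           intro!: poly_ring_sum poly_ring_mult poly_ring_Const poly_ring_Var)
  qed
  then show "is_second_Kravchuk_derivation n (der n ?v)"
    by (auto simp: is_second_Kravchuk_derivation_def der_Var)
qed

end

theory Submission
  imports Defs "HOL-Computational_Algebra.Formal_Power_Series"
begin

unbundle fps_syntax

text \<open>
  The generating function \<open>\<Sum>m. K\<^sub>m z\<^sup>m = (1 - z)\<^sup>x (1 + z)\<^bsup>a - x\<^esup>\<close> turns \<open>\<partial>/\<partial>x\<close> into multiplication by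
  \<open>ln (1 - z) - ln (1 + z)\<close> and \<open>\<partial>/\<partial>a\<close> into multiplication by \<open>ln (1 + z)\<close>. Comparing
  coefficients, the substitution \<open>x\<^sub>m \<mapsto> K\<^sub>m\<close> intertwines the first Kravchuk derivation with
  \<open>-1/2 \<partial>/\<partial>x\<close> and the second one with \<open>\<partial>/\<partial>a\<close>, so kernels are mapped into kernels.
\<close>

text \<open>A name for the embedding of the rationals lets constants be handled by homomorphism laws
  instead of as nested coefficient lists.\<close>

definition scalar :: "rat \<Rightarrow> rat poly poly" where
  "scalar c = [:[:c:]:]"

lemma scalar_0 [simp]: "scalar 0 = 0"
  by (simp add: scalar_def)

lemma scalar_1 [simp]: "scalar 1 = 1"
  by (simp add: scalar_def one_pCons)

lemma scalar_add: "scalar (a + b) = scalar a + scalar b"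
  by (simp add: scalar_def)

lemma scalar_minus: "scalar (- a) = - scalar a"
  by (simp add: scalar_def)

lemma scalar_diff: "scalar (a - b) = scalar a - scalar b"
  by (simp add: scalar_def)

lemma scalar_mult: "scalar (a * b) = scalar a * scalar b"
  by (simp add: scalar_def)

lemma scalar_power: "scalar (a ^ n) = scalar a ^ n"
  by (induction n) (simp_all add: scalar_mult)

lemma scalar_of_nat: "scalar (of_nat n) = of_nat n"
  by (simp add: scalar_def of_nat_poly)

subsection \<open>Substitution\<close>

lemma substitute_add: "substitute k (P + Q) = substitute k P + substitute k Q"
  unfolding substitute_def scalar_def[symmetric]
  by (rule setsum_keys_plus_distrib) (simp_all add: scalar_add algebra_simps)

lemma substitute_0 [simp]: "substitute k 0 = 0"
  by (simp add: substitute_def)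

lemma substitute_sum: "substitute k (sum f A) = (\<Sum>x\<in>A. substitute k (f x))"
  by (induction A rule: infinite_finite_induct) (simp_all add: substitute_add)

lemma substitute_single:
  "substitute k (Poly_Mapping.single m c) =
     scalar c * (\<Prod>i\<in>Poly_Mapping.keys m. k i ^ Poly_Mapping.lookup m i)"
  by (cases "c = 0") (simp_all add: substitute_def flip: scalar_def)

lemma substitute_Const [simp]: "substitute k (Const c) = scalar c"
  by (simp add: Const_def substitute_single)

lemma substitute_Var [simp]: "substitute k (Var i) = k i"
  by (simp add: Var_def substitute_single)

lemma prod_keys_add:
  fixes k :: "'a \<Rightarrow> 'b::comm_monoid_mult"
  shows "(\<Prod>i\<in>Poly_Mapping.keys (m + m'). k i ^ Poly_Mapping.lookup (m + m') i) =
    (\<Prod>i\<in>Poly_Mapping.keys m. k i ^ Poly_Mapping.lookup m i) *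
    (\<Prod>i\<in>Poly_Mapping.keys m'. k i ^ Poly_Mapping.lookup m' i)"
proof -
  let ?A = "Poly_Mapping.keys m \<union> Poly_Mapping.keys m'"
  \<comment> \<open>Indices outside the support have exponent 0 and contribute the factor 1, so all
    three products can range over \<open>?A\<close>.\<close>
  have extend: "(\<Prod>i\<in>Poly_Mapping.keys q. k i ^ Poly_Mapping.lookup q i) =
      (\<Prod>i\<in>?A. k i ^ Poly_Mapping.lookup q i)" if "Poly_Mapping.keys q \<subseteq> ?A" for q
    using that by (intro prod.mono_neutral_left) (auto simp: in_keys_iff)
  show ?thesis
    by (subst (1 2 3) extend)
       (use keys_add[of m m'] in \<open>auto simp: lookup_add power_add prod.distrib\<close>)
qed

lemma substitute_mult: "substitute k (P * Q) = substitute k P * substitute k Q"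
proof -
  let ?s = "\<lambda>P m. Poly_Mapping.single m (Poly_Mapping.lookup P m) :: ratmpoly"
  let ?P = "\<Sum>m\<in>Poly_Mapping.keys P. ?s P m" and ?Q = "\<Sum>m\<in>Poly_Mapping.keys Q. ?s Q m"
  have mono: "substitute k (Poly_Mapping.single m a * Poly_Mapping.single m' b) =
      substitute k (Poly_Mapping.single m a) * substitute k (Poly_Mapping.single m' b)" for m m' a b
    by (simp add: mult_single substitute_single prod_keys_add scalar_mult algebra_simps)
  have "substitute k (?P * ?Q) = substitute k ?P * substitute k ?Q"
    by (simp only: sum_product substitute_sum mono)
  then show ?thesis
    by (simp only: monomials_sum)
qed

text \<open>A derivation is constrained only on \<open>poly_ring n\<close>, hence \<open>add\<close>
  and \<open>mult\<close> supply membership of both operands.\<close>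

lemma poly_ring_induct [consumes 1, case_names Const Var add mult]:
  assumes "P \<in> poly_ring n"
    and Const: "\<And>c. R (Const c)"
    and Var: "\<And>i. i \<le> n \<Longrightarrow> R (Var i)"
    and add: "\<And>f g. f \<in> poly_ring n \<Longrightarrow> g \<in> poly_ring n \<Longrightarrow> R f \<Longrightarrow> R g \<Longrightarrow> R (f + g)"
    and mult: "\<And>f g. f \<in> poly_ring n \<Longrightarrow> g \<in> poly_ring n \<Longrightarrow> R f \<Longrightarrow> R g \<Longrightarrow> R (f * g)"
  shows "R P"
proof -
  let ?R = "\<lambda>f. f \<in> poly_ring n \<and> R f"
  have pow: "?R (Poly_Mapping.single (Poly_Mapping.single i e) 1)" if "i \<le> n" for i e
  proof (induction e)
    case 0
    show ?case using Const[of 1] poly_ring_Const[of 1 n] by (simp add: Const_def)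
  next
    case (Suc e)
    have "Poly_Mapping.single (Poly_Mapping.single i (Suc e)) 1 =
        Var i * Poly_Mapping.single (Poly_Mapping.single i e) (1::rat)"
      by (simp add: Var_def mult_single flip: single_add)
    then show ?case
      using Suc that by (simp add: Var mult poly_ring_mult poly_ring_Var)
  qed
  have monomial: "?R (Poly_Mapping.single m 1)" if "Poly_Mapping.keys m \<subseteq> {0..n}" for m
    using that
  proof (induction m rule: update_induct)
    case const
    show ?case using Const[of 1] poly_ring_Const[of 1 n] by (simp add: Const_def)
  next
    case (update f i e)
    \<comment> \<open>The index \<open>i\<close> is fresh for \<open>f\<close>, so the update adds
      exponent vectors and the monomial factors.\<close>
    have split: "Poly_Mapping.update i e f = f + Poly_Mapping.single i e"
      using update.hyps
      by (intro poly_mapping_eqI) (auto simp: lookup_update lookup_add lookup_single in_keys_iff when_def)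
    have "Poly_Mapping.keys f \<subseteq> {0..n}" "i \<le> n"
      using update.prems update.hyps by (auto simp: keys_update)
    then have "?R (Poly_Mapping.single f 1)" "?R (Poly_Mapping.single (Poly_Mapping.single i e) 1)"
      using update.IH pow by auto
    then have "?R (Poly_Mapping.single f 1 * Poly_Mapping.single (Poly_Mapping.single i e) 1)"
      using mult poly_ring_mult by blast
    then show ?case by (simp add: mult_single split)
  qed
  have monomials: "?R (Poly_Mapping.single m (Poly_Mapping.lookup P m))" if "m \<in> Poly_Mapping.keys P" for m
  proof -
    have "Poly_Mapping.single m (Poly_Mapping.lookup P m) =
        Const (Poly_Mapping.lookup P m) * Poly_Mapping.single m 1"
      by (simp add: Const_def mult_single)
    then show ?thesis
      using monomial[of m] that assms(1) Const
      by (auto simp: poly_ring_def[of n, THEN eqset_imp_iff, of P] intro: mult poly_ring_mult poly_ring_Const)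
  qed
  have "?R (\<Sum>m\<in>A. Poly_Mapping.single m (Poly_Mapping.lookup P m))"
    if "A \<subseteq> Poly_Mapping.keys P" for A
    using that
  proof (induction A rule: infinite_finite_induct)
    case (insert m A)
    then show ?case using monomials[of m] by (auto intro: add poly_ring_add)
  qed (use Const[of 0] poly_ring_Const[of 0 n] in auto)
  from this[of "Poly_Mapping.keys P"] show ?thesis
    by (simp add: monomials_sum)
qed

text \<open>The Leibniz rule for 1 * 1 reads D 1 = D 1 + D 1; linearity then covers every
  constant.\<close>

lemma is_derivation_Const:
  assumes "is_derivation n D"
  shows "D (Const c) = 0"
proof -
  have 1: "Const 1 \<in> poly_ring n"
    by (rule poly_ring_Const)
  have one: "Const 1 = 1"
    by (simp add: Const_def)
  have "D (Const 1 * Const 1) = D (Const 1) * Const 1 + Const 1 * D (Const 1)"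
    using assms 1 unfolding is_derivation_def by blast
  then have "D (Const 1) = 0"
    by (simp add: one)
  moreover have "D (Const c * Const 1) = Const c * D (Const 1)"
    using assms 1 unfolding is_derivation_def by blast
  ultimately show ?thesis
    by (simp add: one)
qed

subsection \<open>Derivations acting on binomial series\<close>

text \<open>Both partial derivatives will be instances, so the series argument is carried out only
  once.\<close>

locale scalar_derivation =
  fixes d :: "rat poly poly \<Rightarrow> rat poly poly"
  assumes d_add: "d (p + q) = d p + d q"
    and d_mult: "d (p * q) = d p * q + p * d q"
    and d_scalar: "d (scalar c) = 0"
begin

lemma d_zero [simp]: "d 0 = 0"
  using d_scalar[of 0] by simp

lemma d_one [simp]: "d 1 = 0"
  using d_scalar[of 1] by simp

lemma d_of_nat [simp]: "d (of_nat n) = 0"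
  using d_scalar[of "of_nat n"] by (simp only: scalar_of_nat)

lemma d_minus: "d (- p) = - d p"
  using d_add[of p "- p"] by (simp add: eq_neg_iff_add_eq_0 add.commute)

lemma d_diff: "d (p - q) = d p - d q"
  using d_add[of p "- q"] by (simp add: d_minus)

lemma d_sum: "d (sum f A) = (\<Sum>x\<in>A. d (f x))"
  by (induction A rule: infinite_finite_induct) (simp_all add: d_add)

text \<open>As functions of \<open>P\<close>, both sides are additive, vanish on constants and obey
  the Leibniz rule along the ring homomorphism \<open>substitute k\<close>, so agreement on the
  variables suffices.\<close>

lemma substitute_intertwines:
  assumes D: "is_derivation n D" and P: "P \<in> poly_ring n"
    and vars: "\<And>m. m \<le> n \<Longrightarrow> d (k m) = c * substitute k (D (Var m))"
  shows "d (substitute k P) = c * substitute k (D P)"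
  using P
proof (induction P rule: poly_ring_induct)
  case (Const r)
  then show ?case
    by (simp add: is_derivation_Const[OF D] d_scalar)
next
  case (Var i)
  then show ?case
    by (simp add: vars)
next
  case (add f g)
  then have "D (f + g) = D f + D g"
    using D unfolding is_derivation_def by blast
  with add show ?case
    by (simp add: substitute_add d_add algebra_simps)
next
  case (mult f g)
  then have "D (f * g) = D f * g + f * D g"
    using D unfolding is_derivation_def by blast
  with mult show ?case
    by (simp add: substitute_mult substitute_add d_mult algebra_simps)
qed

end

section \<open>Differential equations of the binomial and logarithm series\<close>

text \<open>The series \<open>(1 + cz)\<^sup>t\<close> and \<open>ln (1 + cz)\<close>; the constant term of the latter vanishes because
  \<open>x / 0 = 0\<close>.\<close>

definition binomial_series :: "rat poly poly \<Rightarrow> rat poly poly \<Rightarrow> rat poly poly fps" where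
  "binomial_series c t = Abs_fps (\<lambda>m. c ^ m * poly_choose t m)"

definition log_series :: "rat poly poly \<Rightarrow> rat poly poly fps" where
  "log_series c = Abs_fps (\<lambda>m. c ^ m * scalar ((-1) ^ (m + 1) / of_nat m))"

text \<open>The binomial recurrence, cleared of denominators because \<open>rat poly poly\<close> is
  not a field; it is the coefficient form of the equation for (1 + cz)^t.\<close>

lemma poly_choose_Suc: "of_nat (Suc m) * poly_choose t (Suc m) = (t - of_nat m) * poly_choose t m"
proof -
  have "of_nat (Suc m) * scalar (1 / fact (Suc m)) = scalar (1 / fact m)"
    unfolding scalar_of_nat[symmetric] scalar_mult[symmetric] by simp
  then show ?thesis
    unfolding poly_choose_def prod.lessThan_Suc scalar_def[symmetric]
    by (metis (no_types, lifting) mult.assoc mult.commute)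
qed

lemma binomial_series_ode:
  "(1 + fps_const c * fps_X) * fps_deriv (binomial_series c t) = fps_const (c * t) * binomial_series c t"
proof (rule fps_ext)
  fix m
  have nth: "of_nat (Suc m) * binomial_series c t $ Suc m = c * (t - of_nat m) * binomial_series c t $ m" for m
  proof -
    have "of_nat (Suc m) * (c ^ Suc m * poly_choose t (Suc m)) =
        c ^ Suc m * ((t - of_nat m) * poly_choose t m)"
      unfolding poly_choose_Suc[symmetric] by (simp only: mult_ac)
    then show ?thesis
      by (simp add: binomial_series_def mult_ac del: of_nat_Suc)
  qed
  \<comment> \<open>At \<open>m = 0\<close> the shifted series has no coefficient, which agrees with
    the factor \<open>of_nat m\<close>.\<close>
  have "((1 + fps_const c * fps_X) * fps_deriv F) $ m =
      of_nat (Suc m) * F $ Suc m + c * (of_nat m * F $ m)" for F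
    by (cases m) (simp_all add: distrib_right mult.assoc del: of_nat_Suc)
  then show "((1 + fps_const c * fps_X) * fps_deriv (binomial_series c t)) $ m =
      (fps_const (c * t) * binomial_series c t) $ m"
    by (simp add: nth algebra_simps del: of_nat_Suc)
qed

text \<open>The derivative is \<open>c\<close> times the geometric series in -cz, so multiplying by
  1 + cz telescopes.\<close>

lemma log_series_ode: "(1 + fps_const c * fps_X) * fps_deriv (log_series c) = fps_const c"
proof (rule fps_ext)
  fix m
  have nth: "of_nat (Suc m) * log_series c $ Suc m = c ^ Suc m * (-1) ^ m" for m
  proof -
    have "of_nat (Suc m) * scalar ((-1) ^ (Suc m + 1) / of_nat (Suc m)) = scalar ((-1) ^ m)"
      unfolding scalar_of_nat[symmetric] scalar_mult[symmetric] by simp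
    also have "scalar ((-1) ^ m) = (-1) ^ m"
      by (simp add: scalar_power scalar_minus)
    finally show ?thesis
      unfolding log_series_def by (simp add: mult.left_commute del: of_nat_Suc)
  qed
  show "((1 + fps_const c * fps_X) * fps_deriv (log_series c)) $ m = fps_const c $ m"
    by (cases m) (simp_all add: distrib_right mult.assoc nth del: of_nat_Suc)
qed

text \<open>The equation expresses (m + 1) times coefficient m + 1 through coefficient m, and m + 1
  can be cancelled in characteristic 0.\<close>

lemma binomial_ode_unique:
  fixes F :: "rat poly poly fps"
  assumes ode: "(1 + fps_const c * fps_X) * fps_deriv F = fps_const s * F" and "F $ 0 = 0"
  shows "F = 0"
proof (rule fps_ext)
  fix m
  show "F $ m = 0 $ m"
  proof (induction m)
    case (Suc m)
    have "((1 + fps_const c * fps_X) * fps_deriv F) $ m = (fps_const s * F) $ m"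
      by (simp only: ode)
    with Suc have "of_nat (Suc m) * F $ Suc m = 0"
      by (cases m) (simp_all add: distrib_right mult.assoc del: of_nat_Suc)
    then show ?case
      by (simp del: of_nat_Suc)
  qed (use assms in simp)
qed

context scalar_derivation
begin

text \<open>This differentiates in a parameter, not in z; it commutes with \<open>fps_deriv\<close>,
  so \<open>d\<close> can be applied to the differential equation itself.\<close>

definition coeffwise :: "rat poly poly fps \<Rightarrow> rat poly poly fps" where
  "coeffwise F = Abs_fps (\<lambda>m. d (F $ m))"

lemma coeffwise_nth [simp]: "coeffwise F $ m = d (F $ m)"
  by (simp add: coeffwise_def)

lemma coeffwise_mult: "coeffwise (F * G) = coeffwise F * G + F * coeffwise G"
  by (rule fps_ext) (simp add: fps_mult_nth d_sum d_mult sum.distrib)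

lemma coeffwise_deriv: "coeffwise (fps_deriv F) = fps_deriv (coeffwise F)"
  by (rule fps_ext) (simp add: d_mult del: of_nat_Suc)

text \<open>The difference of both sides satisfies the differential equation of \<open>(1 + cz)\<^sup>t\<close> and has constant
  term \<open>0\<close>.\<close>

lemma coeffwise_binomial_series:
  assumes c: "d c = 0"
  shows "coeffwise (binomial_series c t) = fps_const (d t) * log_series c * binomial_series c t"
proof -
  let ?B = "binomial_series c t" and ?L = "log_series c" and ?u = "1 + fps_const c * fps_X :: rat poly poly fps"
  let ?E = "coeffwise ?B - fps_const (d t) * ?L * ?B"
  have u: "coeffwise ?u = 0"
    by (rule fps_ext) (auto simp: c d_add fps_X_def)
  have ct: "coeffwise (fps_const (c * t)) = fps_const (c * d t)"
    by (rule fps_ext) (auto simp: c d_mult)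
  have "?u * fps_deriv (coeffwise ?B) = coeffwise (?u * fps_deriv ?B)"
    by (simp add: coeffwise_mult coeffwise_deriv u)
  also have "\<dots> = fps_const (c * d t) * ?B + fps_const (c * t) * coeffwise ?B"
    by (simp only: binomial_series_ode coeffwise_mult ct)
  finally have 1: "?u * fps_deriv (coeffwise ?B) = \<dots>" .
  \<comment> \<open>The logarithm produces the same inhomogeneous term
    \<open>fps_const (c * d t) * ?B\<close> as in 1, so it cancels in \<open>?E\<close>.\<close>
  have "?u * fps_deriv (fps_const (d t) * ?L * ?B) =
      fps_const (d t) * ((?u * fps_deriv ?L) * ?B + ?L * (?u * fps_deriv ?B))"
    by (simp add: algebra_simps)
  also have "\<dots> = fps_const (c * d t) * ?B + fps_const (c * t) * (fps_const (d t) * ?L * ?B)"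
    unfolding log_series_ode binomial_series_ode by (simp add: algebra_simps flip: fps_const_mult)
  finally have "?u * fps_deriv ?E = fps_const (c * t) * ?E"
    using 1 by (simp only: fps_deriv_sub right_diff_distrib) simp
  moreover have "?E $ 0 = 0"
    by (simp add: binomial_series_def log_series_def poly_choose_def flip: scalar_def)
  ultimately have "?E = 0"
    by (rule binomial_ode_unique)
  then show ?thesis by simp
qed

end

subsection \<open>Kravchuk polynomials\<close>

lemma Kravchuk_series:
  "Abs_fps Kravchuk = binomial_series (-1) var_x * binomial_series 1 (var_a - var_x)"
  by (rule fps_ext) (simp add: fps_mult_nth binomial_series_def Kravchuk_def)

text \<open>By the product rule, \<open>d\<close> multiplies the generating function by the sum of
  the two logarithmic factors; the claim is its coefficient at z^m.\<close>

lemma (in scalar_derivation) d_Kravchuk: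
  "d (Kravchuk m) =
    (\<Sum>i = 0..m. (d var_x * log_series (-1) $ i + d (var_a - var_x) * log_series 1 $ i) * Kravchuk (m - i))"
proof -
  let ?L = "fps_const (d var_x) * log_series (-1) + fps_const (d (var_a - var_x)) * log_series 1"
  have "coeffwise (Abs_fps Kravchuk) = ?L * Abs_fps Kravchuk"
    by (simp add: Kravchuk_series coeffwise_mult coeffwise_binomial_series d_minus algebra_simps)
  then have "coeffwise (Abs_fps Kravchuk) $ m = (?L * Abs_fps Kravchuk) $ m"
    by simp
  then show ?thesis
    by (simp add: fps_mult_nth[of ?L])
qed

text \<open>The outer variable is x and the inner one is a, so \<open>pderiv\<close> is the partial
  derivative in x and \<open>map_poly pderiv\<close> the one in a.\<close>

interpretation dx: scalar_derivation pderiv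
  by unfold_locales (simp_all add: pderiv_add pderiv_mult scalar_def)

interpretation da: scalar_derivation "map_poly pderiv"
proof
  have leibniz: "pderiv (u * v) = pderiv u * v + u * pderiv v" for u v :: "rat poly"
    by (simp add: pderiv_mult mult.commute)
  show "map_poly pderiv (p + q) = map_poly pderiv p + map_poly pderiv q" for p q :: "rat poly poly"
    by (rule poly_eqI) (simp add: coeff_map_poly pderiv_add)
  show "map_poly pderiv (p * q) = map_poly pderiv p * q + p * map_poly pderiv q" for p q :: "rat poly poly"
    by (rule poly_eqI)
       (simp add: coeff_map_poly coeff_mult higher_pderiv_sum[of "Suc 0", simplified]
          leibniz sum.distrib)
  show "map_poly pderiv (scalar c) = 0" for c
    by (simp add: scalar_def map_poly_pCons)
qed

text \<open>Here d x = 1 and d (a - x) = -1, leaving ln (1 - z) - ln (1 + z): even powers cancel and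
  odd ones double, whence the factor -2.\<close>

lemma pderiv_Kravchuk:
  assumes "is_first_Kravchuk_derivation n D" "m \<le> n"
  shows "pderiv (Kravchuk m) = scalar (- 2) * substitute Kravchuk (D (Var m))"
proof -
  have coeff: "log_series (-1) $ i - log_series 1 $ i = scalar (- 2 * ((1 - (-1) ^ i) / (2 * of_nat i)))" for i
  proof -
    have "log_series (-1) $ i = scalar ((-1) ^ i * ((-1) ^ (i + 1) / of_nat i))"
      by (simp only: log_series_def fps_nth_Abs_fps scalar_mult scalar_power scalar_minus scalar_1)
    moreover have "log_series 1 $ i = scalar ((-1) ^ (i + 1) / of_nat i)"
      by (simp add: log_series_def)
    moreover have "(-1) ^ i * ((-1) ^ (i + 1) / of_nat i) - (-1) ^ (i + 1) / of_nat i =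
        - 2 * ((1 - (-1) ^ i) / (2 * rat_of_nat i))"
      by (cases "even i") simp_all
    ultimately show ?thesis
      by (simp only: scalar_diff[symmetric])
  qed
  have "pderiv (Kravchuk m) =
      (\<Sum>i = 0..m. scalar (- 2 * ((1 - (-1) ^ i) / (2 * of_nat i))) * Kravchuk (m - i))"
    unfolding dx.d_Kravchuk coeff[symmetric]
    by (simp add: var_x_def var_a_def pderiv_diff pderiv_pCons)
  \<comment> \<open>The term \<open>i = 0\<close> drops out, since its numerator 1 - (-1)^0 is
    zero.\<close>
  also have "\<dots> = scalar (- 2) * (\<Sum>i = 1..m. scalar ((1 - (-1) ^ i) / (2 * of_nat i)) * Kravchuk (m - i))"
    unfolding scalar_mult by (simp add: sum.atLeast_Suc_atMost sum_distrib_left mult.assoc)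
  also have "(\<Sum>i = 1..m. scalar ((1 - (-1) ^ i) / (2 * of_nat i)) * Kravchuk (m - i)) =
      substitute Kravchuk (D (Var m))"
    using assms by (cases "m = 0")
      (auto simp: is_first_Kravchuk_derivation_def substitute_sum substitute_mult)
  finally show ?thesis .
qed

text \<open>Here d x = 0 and d (a - x) = 1, so only ln (1 + z) survives.\<close>

lemma map_poly_pderiv_Kravchuk:
  assumes "is_second_Kravchuk_derivation n D" "m \<le> n"
  shows "map_poly pderiv (Kravchuk m) = substitute Kravchuk (D (Var m))"
proof (cases "m = 0")
  case False
  have "map_poly pderiv (Kravchuk m) = (\<Sum>i = 0..m. log_series 1 $ i * Kravchuk (m - i))"
    unfolding da.d_Kravchuk
    by (simp add: da.d_diff) (simp add: var_x_def var_a_def map_poly_pCons pderiv_pCons flip: one_pCons)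
  also have "\<dots> = (\<Sum>i = 0..m. log_series 1 $ (m - i) * Kravchuk i)"
    by (rule sum.reindex_bij_witness[of _ "\<lambda>i. m - i" "\<lambda>i. m - i"]) auto
  \<comment> \<open>The term \<open>i = m\<close> carries the constant coefficient of the logarithm,
    which is 0.\<close>
  also have "\<dots> = (\<Sum>i = 0..m - 1. log_series 1 $ (m - i) * Kravchuk i)"
    using False by (cases m) (simp_all add: log_series_def)
  also have "\<dots> = (\<Sum>i = 0..m - 1. scalar ((-1) ^ (m + 1 + i) / of_nat (m - i)) * Kravchuk i)"
  proof (intro sum.cong refl)
    fix i assume "i \<in> {0..m - 1}"
    \<comment> \<open>For i at most m, the truncated difference m - i and the sum m + i have the
      same parity.\<close>
    then have "(-1::rat) ^ (m - i + 1) = (-1) ^ (m + 1 + i)"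
      by (auto simp: minus_one_power_iff)
    then show "log_series 1 $ (m - i) * Kravchuk i =
        scalar ((-1) ^ (m + 1 + i) / of_nat (m - i)) * Kravchuk i"
      by (simp add: log_series_def)
  qed
  finally show ?thesis
    using assms False
    by (auto simp: is_second_Kravchuk_derivation_def substitute_sum substitute_mult)
qed (use assms in \<open>auto simp: is_second_Kravchuk_derivation_def da.d_Kravchuk log_series_def\<close>)

section \<open>Kernels of the two partial derivatives\<close>

lemma pderiv_eq_0_in_Q_a: "pderiv p = 0 \<Longrightarrow> p \<in> Q_a"
  unfolding Q_a_def by (metis pderiv_iszero rangeI)

lemma map_poly_pderiv_eq_0_in_Q_x:
  assumes "map_poly pderiv p = 0"
  shows "p \<in> Q_x"
proof -
  have "pderiv (coeff p i) = 0" for i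
    using assms by (metis coeff_0 coeff_map_poly pderiv_0)
  then have "coeff p i = [:coeff (coeff p i) 0:]" for i
    by (metis coeff_pCons_0 pderiv_iszero)
  \<comment> \<open>Every x-coefficient is constant in a, so its value is read off as its
    coefficient at a^0.\<close>
  then have "p = map_poly (\<lambda>c. [:c:]) (map_poly (\<lambda>q. coeff q 0) p)"
    by (intro poly_eqI) (simp add: coeff_map_poly)
  then show ?thesis
    unfolding Q_x_def by blast
qed

theorem theorem2p2:
  fixes n :: nat and P :: ratmpoly and D1 D2 :: "ratmpoly \<Rightarrow> ratmpoly"
  assumes "P \<in> poly_ring n"
    and "is_first_Kravchuk_derivation n D1"
    and "is_second_Kravchuk_derivation n D2"
  shows "(D1 P = 0 \<longrightarrow> substitute Kravchuk P \<in> Q_a) \<and>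
         (D2 P = 0 \<longrightarrow> substitute Kravchuk P \<in> Q_x)"
proof -
  have "is_derivation n D1" "is_derivation n D2"
    using assms
    by (auto simp: is_first_Kravchuk_derivation_def is_second_Kravchuk_derivation_def)
  then have "pderiv (substitute Kravchuk P) = scalar (- 2) * substitute Kravchuk (D1 P)"
    and "map_poly pderiv (substitute Kravchuk P) = substitute Kravchuk (D2 P)"
    using assms dx.substitute_intertwines[where D = D1] da.substitute_intertwines[where D = D2 and c = 1, unfolded mult_1]
      pderiv_Kravchuk map_poly_pderiv_Kravchuk by blast+
  then show ?thesis
    by (simp add: pderiv_eq_0_in_Q_a map_poly_pderiv_eq_0_in_Q_x)
qed

end
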